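(* Let $d=(d_1,\ldots,d_n)$ be a degree sequence with $d_4\ge 2$, $\sum_i d_i>2n$ and $\mu_1>0$, and let $m=\frac12\sum_i d_i$. Then $d$ has a core bipartite cactus realization if and only if $\mu_1\ge\mu_{odd}$ and $m\le\left\lfloor\frac{4(n-1)-\mu_1}{3}\right\rfloor$.
   Context: A degree sequence is a sequence of integers $d_i\in\{1,\ldots,n-1\}$ with even sum and $d_1\ge\cdots\ge d_n$; a realization is a simple graph on $\{1,\ldots,n\}$ with $\deg(i)=d_i$. A cactus is a connected simple graph in which every edge lies on at most one cycle; a bridge is an edge whose removal disconnects the graph; a core cactus is a cactus with no bridge whose removal splits the graph into two components each containing a cycle; a core bi-cactus is a core cactus that is bipartite. $\mu_1$ is the number of entries of $d$ equal to $1$, and $\mu_{odd}$ is the number of entries that are odd integers greater than $1$. *)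

theory Defs
  imports Complex_Main
begin

definition simple_graph :: "nat set \<Rightarrow> nat set set \<Rightarrow> bool" where
  "simple_graph V E \<longleftrightarrow> (\<forall>e\<in>E. e \<subseteq> V \<and> card e = 2)"

definition deg :: "nat set set \<Rightarrow> nat \<Rightarrow> nat" where
  "deg E v = card {e \<in> E. v \<in> e}"

definition reach :: "nat set set \<Rightarrow> nat \<Rightarrow> nat \<Rightarrow> bool" where
  "reach E = (\<lambda>x y. {x, y} \<in> E)\<^sup>*\<^sup>*"

definition connected_graph :: "nat set \<Rightarrow> nat set set \<Rightarrow> bool" where
  "connected_graph V E \<longleftrightarrow> (\<forall>u\<in>V. \<forall>v\<in>V. reach E u v)"

definition cycle_edges :: "nat list \<Rightarrow> nat set set" where
  "cycle_edges vs = set (map (\<lambda>i. {vs ! i, vs ! ((i + 1) mod length vs)}) [0..<length vs])"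

definition is_cycle :: "nat set set \<Rightarrow> nat set set \<Rightarrow> bool" where
  "is_cycle E C \<longleftrightarrow> (\<exists>vs. distinct vs \<and> length vs \<ge> 3 \<and> C = cycle_edges vs \<and> C \<subseteq> E)"

definition cactus :: "nat set \<Rightarrow> nat set set \<Rightarrow> bool" where
  "cactus V E \<longleftrightarrow> simple_graph V E \<and> connected_graph V E \<and>
     (\<forall>e\<in>E. \<forall>C1 C2. is_cycle E C1 \<and> is_cycle E C2 \<and> e \<in> C1 \<and> e \<in> C2 \<longrightarrow> C1 = C2)"

definition bridge :: "nat set \<Rightarrow> nat set set \<Rightarrow> nat set \<Rightarrow> bool" where
  "bridge V E e \<longleftrightarrow> e \<in> E \<and> \<not> connected_graph V (E - {e})"

(* removal of e leaves two vertices x, y in different components, each lying on a cycle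
   of its component (so both components contain a cycle) *)
definition core_cactus :: "nat set \<Rightarrow> nat set set \<Rightarrow> bool" where
  "core_cactus V E \<longleftrightarrow> cactus V E \<and>
     (\<forall>e. bridge V E e \<longrightarrow>
        \<not> (\<exists>C1 C2 x y. is_cycle (E - {e}) C1 \<and> is_cycle (E - {e}) C2 \<and>
              x \<in> \<Union>C1 \<and> y \<in> \<Union>C2 \<and> \<not> reach (E - {e}) x y))"

definition bipartite :: "nat set set \<Rightarrow> bool" where
  "bipartite E \<longleftrightarrow> (\<exists>f :: nat \<Rightarrow> bool. \<forall>u v. {u, v} \<in> E \<longrightarrow> f u \<noteq> f v)"

definition core_bi_cactus :: "nat set \<Rightarrow> nat set set \<Rightarrow> bool" where
  "core_bi_cactus V E \<longleftrightarrow> core_cactus V E \<and> bipartite E"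

definition degree_sequence :: "nat \<Rightarrow> (nat \<Rightarrow> nat) \<Rightarrow> bool" where
  "degree_sequence n d \<longleftrightarrow> (\<forall>i\<in>{1..n}. 1 \<le> d i \<and> d i \<le> n - 1) \<and>
     even (\<Sum>i=1..n. d i) \<and> (\<forall>i j. 1 \<le> i \<and> i \<le> j \<and> j \<le> n \<longrightarrow> d j \<le> d i)"

definition realization :: "nat \<Rightarrow> (nat \<Rightarrow> nat) \<Rightarrow> nat set set \<Rightarrow> bool" where
  "realization n d E \<longleftrightarrow> simple_graph {1..n} E \<and> (\<forall>i\<in>{1..n}. deg E i = d i)"

definition mu1 :: "nat \<Rightarrow> (nat \<Rightarrow> nat) \<Rightarrow> nat" where
  "mu1 n d = card {i\<in>{1..n}. d i = 1}"

definition mu_odd :: "nat \<Rightarrow> (nat \<Rightarrow> nat) \<Rightarrow> nat" where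
  "mu_odd n d = card {i\<in>{1..n}. odd (d i) \<and> d i > 1}"

end

theory Submission
  imports Defs
begin

text \<open>
  Necessity. Let \<open>B\<close> be the set of edges on no cycle and \<open>K\<close> the set of vertices on cycles. In a core
  cactus each edge of \<open>B\<close> cuts one of its endpoints off from \<open>K\<close>, and distinct edges cut off distinct
  endpoints, so \<open>|B| + |K| \<le> n\<close>. Every vertex has even degree outside \<open>B\<close>; counting the degrees in \<open>B\<close>
  then gives \<open>\<mu>\<^sub>o\<^sub>d\<^sub>d \<le> \<mu>\<^sub>1\<close>. There are at least \<open>m - n + 1\<close> cycles, which are edge-disjoint with at least
  four edges each, and \<open>B\<close> contains at least \<open>\<mu>\<^sub>1\<close> edges; this gives the bound on \<open>m\<close>.

  Sufficiency. Let \<open>U\<close> be the set of vertices of degree at least 2 and \<open>c = m - n\<close>. Distribute the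
  leaves over \<open>U\<close> so that each \<open>v\<close> keeps an even remaining degree \<open>2 r(v) \<ge> 2\<close>. Then
  \<open>\<Sum>(r(v) - 1) = c\<close> and \<open>|U| \<ge> 3c + 4\<close>. If \<open>|U| - 3c\<close> is even, one even cycle and \<open>c\<close> attached 4-cycles
  realise the degrees \<open>2 r\<close> on \<open>U\<close>; otherwise one vertex with \<open>r = 1\<close> is first moved onto the edge to
  a leaf.
\<close>

section \<open>Reachability and cycles\<close>

lemma reach_refl [simp]: "reach E x x"
  by (simp add: reach_def)

lemma reach_edge: "{x, y} \<in> E \<Longrightarrow> reach E x y"
  by (simp add: reach_def r_into_rtranclp)

lemma reach_trans [trans]: "reach E x y \<Longrightarrow> reach E y z \<Longrightarrow> reach E x z"
  unfolding reach_def by (rule rtranclp_trans)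

lemma reach_sym: "reach E x y \<Longrightarrow> reach E y x"
  unfolding reach_def
  by (rule sympD[OF symp_rtranclp]) (auto simp: symp_def insert_commute)

lemma reach_mono: "reach E x y \<Longrightarrow> E \<subseteq> F \<Longrightarrow> reach F x y"
  unfolding reach_def by (erule rtranclp_mono[THEN predicate2D, rotated]) auto

lemma reach_closed:
  assumes "reach E x y" "x \<in> S" "\<And>a b. {a, b} \<in> E \<Longrightarrow> a \<in> S \<Longrightarrow> b \<in> S"
  shows "y \<in> S"
  using assms(1,2) unfolding reach_def by (induction rule: rtranclp_induct) (auto intro: assms(3))

lemma reach_replace:
  assumes "reach E x y" "\<And>a b. {a, b} \<in> E \<Longrightarrow> reach F a b"
  shows "reach F x y"
  using assms(1) unfolding reach_def[of E]
proof (induction rule: rtranclp_induct)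
  case (step y z)
  then show ?case using assms(2) reach_trans by blast
qed simp

text \<open>A walk from \<open>b\<close> to \<open>s\<close> is cut at its last visit to
  \<open>b\<close>: what follows the next vertex \<open>a\<close> uses no edge at
  \<open>b\<close>.\<close>

lemma reach_last_departure:
  assumes "reach E b s" "b \<noteq> s"
  obtains a where "{b, a} \<in> E" "reach (E - {e. b \<in> e}) a s"
proof -
  have isolated: "\<not> reach (E - {e. b \<in> e}) b s"
  proof
    assume "reach (E - {e. b \<in> e}) b s"
    then have "s \<in> {b}" by (rule reach_closed) auto
    with assms(2) show False by simp
  qed
  \<comment> \<open>Induction from the end of the walk needs an arbitrary start \<open>x\<close>:
    either no edge at \<open>b\<close> is required, or a departure from \<open>b\<close> is already
    known.\<close>
  have "reach (E - {e. b \<in> e}) x s \<or> (\<exists>a. {b, a} \<in> E \<and> reach (E - {e. b \<in> e}) a s)"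
    if "reach E x s" for x
    using that unfolding reach_def[of E]
  proof (induction rule: converse_rtranclp_induct)
    case (step y z)
    then show ?case using isolated
      by (cases "b = y"; cases "b = z")
        (auto intro: reach_trans[OF reach_edge] simp: insert_commute)
  qed auto
  then show ?thesis using assms(1) isolated that by blast
qed

lemma reach_path:
  assumes "reach E x y"
  obtains p where "distinct p" "p \<noteq> []" "hd p = x" "last p = y"
    "successively (\<lambda>a b. {a, b} \<in> E) p"
proof -
  have "\<exists>p. distinct p \<and> p \<noteq> [] \<and> hd p = x \<and> last p = y \<and> successively (\<lambda>a b. {a, b} \<in> E) p"
    using assms unfolding reach_def
  proof (induction rule: converse_rtranclp_induct)
    case base
    show ?case by (rule exI[of _ "[y]"]) auto
  next
    case (step x z)
    then obtain p where p: "distinct p" "p \<noteq> []" "hd p = z" "last p = y"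
      "successively (\<lambda>a b. {a, b} \<in> E) p" by blast
    show ?case
    proof (cases "x \<in> set p")
      case True
      then obtain q r where "p = q @ x # r" by (meson split_list)
      with p show ?thesis
        by (intro exI[of _ "x # r"]) (auto simp: successively_append_iff)
    next
      case False
      with p step show ?thesis
        by (intro exI[of _ "x # p"]) (auto simp: successively_Cons)
    qed
  qed
  then show ?thesis using that by blast
qed

lemma edge_ends:
  assumes "simple_graph V E" "e \<in> E"
  obtains x y where "e = {x, y}" "x \<noteq> y" "x \<in> V" "y \<in> V"
proof -
  have "e \<subseteq> V" "card e = 2" using assms by (auto simp: simple_graph_def)
  then show ?thesis using that by (auto simp: card_2_iff)
qed

lemma simple_graph_finite: "simple_graph V E \<Longrightarrow> finite V \<Longrightarrow> finite E"
  by (rule finite_subset[of _ "Pow V"]) (auto simp: simple_graph_def)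

text \<open>Each edge of \<open>B\<close> selects an endpoint cut off from \<open>S\<close>, which
  lies outside \<open>S\<close>. The selection is injective: the last departure from a selected
  \<open>b\<close> towards \<open>S\<close> uses one edge at \<open>b\<close>, and removing any
  other edge at \<open>b\<close> leaves that route intact. With \<open>S\<close> a single root this
  bounds the edges of a forest; with \<open>S\<close> the vertices on cycles it bounds the bridges
  of a core cactus.\<close>

lemma card_cut_edges_le:
  assumes V: "finite V" "simple_graph V E" "connected_graph V E" and S: "S \<subseteq> V" "S \<noteq> {}"
    and B: "B \<subseteq> E" "\<And>e. e \<in> B \<Longrightarrow> \<exists>b\<in>e. \<forall>s\<in>S. \<not> reach (E - {e}) b s"
  shows "card B + card S \<le> card V"
proof -
  obtain f where f: "\<And>e. e \<in> B \<Longrightarrow> f e \<in> e" "\<And>e s. e \<in> B \<Longrightarrow> s \<in> S \<Longrightarrow> \<not> reach (E - {e}) (f e) s"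
    using B(2) by metis
  obtain s where s: "s \<in> S" using S by blast
  have sub: "f ` B \<subseteq> V - S"
  proof
    fix v assume "v \<in> f ` B"
    then obtain e where "e \<in> B" "v = f e" by blast
    then show "v \<in> V - S"
      using f(1)[of e] f(2)[of e v] B(1) V(2) unfolding simple_graph_def by auto
  qed
  have "inj_on f B"
  proof (rule inj_onI, rule ccontr)
    fix e e' assume e: "e \<in> B" "e' \<in> B" "f e = f e'" "e \<noteq> e'"
    have "f e \<in> V" "f e \<noteq> s" using sub e s by auto
    then obtain a where a: "{f e, a} \<in> E" "reach (E - {g. f e \<in> g}) a s"
      using V(3) s S reach_last_departure[of E "f e" s] unfolding connected_graph_def by blast
    have "reach (E - {g}) (f e) s" if "f e \<in> g" "{f e, a} \<noteq> g" for g
    proof (rule reach_trans[OF reach_edge reach_mono[OF a(2)]])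
      show "{f e, a} \<in> E - {g}" "E - {g. f e \<in> g} \<subseteq> E - {g}" using a(1) that by auto
    qed
    then have "{f e, a} = e" "{f e, a} = e'" using e(1-3) s f by metis+
    with e(4) show False by simp
  qed
  then have "card B \<le> card (V - S)"
    using sub V(1) by (meson card_inj_on_le finite_Diff)
  moreover have "card (V - S) = card V - card S" "card S \<le> card V"
    using S V by (auto simp: card_Diff_subset card_mono finite_subset)
  ultimately show ?thesis by linarith
qed

section \<open>Cycles as cyclic vertex lists\<close>

text \<open>Indexing edges by position reduces distinctness and degrees to arithmetic modulo the
  length.\<close>

definition cycle_edge :: "nat list \<Rightarrow> nat \<Rightarrow> nat set" where
  "cycle_edge vs i = {vs ! i, vs ! ((i + 1) mod length vs)}"

lemma cycle_edges_conv: "cycle_edges vs = cycle_edge vs ` {..<length vs}"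
  unfolding cycle_edges_def cycle_edge_def by auto

lemma cyclic_succ_nth_eq:
  assumes "distinct vs" "i < length vs" "j < length vs"
  shows "vs ! i = vs ! ((j + 1) mod length vs) \<longleftrightarrow> i = (j + 1) mod length vs"
proof -
  have "(j + 1) mod length vs < length vs" using assms by (intro mod_less_divisor) auto
  then show ?thesis using assms by (simp only: nth_eq_iff_index_eq)
qed

lemma Suc_mod_less: "i < k \<Longrightarrow> (i + 1) mod k = (if i + 1 = k then 0 else i + 1)" for k :: nat
  by auto

text \<open>Positions with the same edge agree or are each other's cyclic successor; the latter
  would force the length to divide 2.\<close>

lemma inj_on_cycle_edge:
  assumes "distinct vs" "length vs \<ge> 3"
  shows "inj_on (cycle_edge vs) {..<length vs}"
proof (rule inj_onI)
  fix i j assume *: "i \<in> {..<length vs}" "j \<in> {..<length vs}" "cycle_edge vs i = cycle_edge vs j"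
  then have "vs ! i = vs ! j \<or> vs ! i = vs ! ((j + 1) mod length vs) \<and> vs ! j = vs ! ((i + 1) mod length vs)"
    unfolding cycle_edge_def by (auto simp: doubleton_eq_iff)
  then have "i = j \<or> i = (j + 1) mod length vs \<and> j = (i + 1) mod length vs"
    using * assms cyclic_succ_nth_eq[of vs i j] cyclic_succ_nth_eq[of vs j i]
    by (auto simp: nth_eq_iff_index_eq)
  then show "i = j"
    using * assms(2) Suc_mod_less[of i "length vs"] Suc_mod_less[of j "length vs"]
    by (auto split: if_splits)
qed

lemma card_cycle_edges: "distinct vs \<Longrightarrow> length vs \<ge> 3 \<Longrightarrow> card (cycle_edges vs) = length vs"
  by (simp add: cycle_edges_conv card_image inj_on_cycle_edge)

lemma Union_cycle_edges [simp]: "\<Union> (cycle_edges vs) = set vs"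
proof
  show "\<Union> (cycle_edges vs) \<subseteq> set vs"
    by (auto simp: cycle_edges_conv cycle_edge_def intro!: nth_mem mod_less_divisor)
  show "set vs \<subseteq> \<Union> (cycle_edges vs)"
    by (fastforce simp: cycle_edges_conv cycle_edge_def in_set_conv_nth)
qed

lemma deg_cycle_edges:
  assumes "distinct vs" "length vs \<ge> 3" "v \<in> set vs"
  shows "deg (cycle_edges vs) v = 2"
proof -
  let ?k = "length vs"
  obtain i where i: "i < ?k" "v = vs ! i" using assms(3) by (auto simp: in_set_conv_nth)
  \<comment> \<open>The cyclic predecessor of \<open>i\<close>: exactly the edges at positions
    \<open>i\<close> and \<open>j\<close> contain \<open>v\<close>.\<close>
  define j where "j = (if i = 0 then ?k - 1 else i - 1)"
  have j: "j < ?k" "(j + 1) mod ?k = i" using i unfolding j_def by (auto simp: Suc_mod_less)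
  have "v \<in> cycle_edge vs l \<longleftrightarrow> l = i \<or> l = j" if "l < ?k" for l
  proof -
    have "v \<in> cycle_edge vs l \<longleftrightarrow> l = i \<or> (l + 1) mod ?k = i"
      using that i assms(1) cyclic_succ_nth_eq[of vs i l]
      unfolding cycle_edge_def by (auto simp: nth_eq_iff_index_eq)
    also have "(l + 1) mod ?k = i \<longleftrightarrow> l = j"
      using that i Suc_mod_less[of l ?k] unfolding j_def by (auto split: if_splits)
    finally show ?thesis .
  qed
  then have "{e \<in> cycle_edges vs. v \<in> e} = cycle_edge vs ` {i, j}"
    using i(1) j(1) unfolding cycle_edges_conv by auto
  moreover have "inj_on (cycle_edge vs) {i, j}"
    using inj_on_cycle_edge[OF assms(1,2)] by (rule inj_on_subset) (use i j in auto)
  moreover have "i \<noteq> j" using i assms(2) unfolding j_def by auto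
  ultimately show ?thesis unfolding deg_def by (simp add: card_image)
qed

lemma reach_cycle_minus_edge:
  assumes "distinct vs" "length vs \<ge> 3" "{x, y} \<in> cycle_edges vs"
  shows "reach (cycle_edges vs - {{x, y}}) x y"
proof -
  let ?k = "length vs"
  obtain i where i: "i < ?k" "{x, y} = cycle_edge vs i"
    using assms(3) by (auto simp: cycle_edges_conv)
  have k: "?k > 0" using assms by auto
  \<comment> \<open>The long way round: starting just after edge \<open>i\<close>, fewer than
    \<open>?k\<close> steps never traverse edge \<open>i\<close>, and \<open>?k - 1\<close> steps
    arrive at its other end.\<close>
  have "reach (cycle_edges vs - {{x, y}}) (vs ! ((i + 1) mod ?k)) (vs ! ((i + 1 + j) mod ?k))"
    if "j < ?k" for j
    using that
  proof (induction j)
    case (Suc j)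
    let ?l = "(i + 1 + j) mod ?k"
    have "?l \<noteq> i"
    proof
      assume "?l = i"
      then have "(i + 1 + j) mod ?k = i mod ?k" using i by simp
      then have "?k dvd (1 + j)"
        by (metis add.assoc add_diff_cancel_left' le_add1 mod_eq_dvd_iff_nat)
      then show False using Suc.prems by (auto dest: dvd_imp_le)
    qed
    then have "cycle_edge vs ?l \<noteq> {x, y}"
      using i inj_on_cycle_edge[OF assms(1,2)] k by (auto simp: inj_on_def)
    moreover have "cycle_edge vs ?l \<in> cycle_edges vs"
      using k by (auto simp: cycle_edges_conv)
    moreover have "cycle_edge vs ?l = {vs ! ?l, vs ! ((i + 1 + Suc j) mod ?k)}"
      by (simp add: cycle_edge_def mod_Suc_eq)
    ultimately have "reach (cycle_edges vs - {{x, y}}) (vs ! ?l) (vs ! ((i + 1 + Suc j) mod ?k))"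
      by (intro reach_edge) auto
    then show ?case using Suc by (auto intro: reach_trans)
  qed auto
  from this[of "?k - 1"] have
    "reach (cycle_edges vs - {{x, y}}) (vs ! ((i + 1) mod ?k)) (vs ! i)"
    using k i by auto
  moreover have "x = vs ! i \<and> y = vs ! ((i + 1) mod ?k) \<or> y = vs ! i \<and> x = vs ! ((i + 1) mod ?k)"
    using i(2) unfolding cycle_edge_def by (auto simp: doubleton_eq_iff)
  ultimately show ?thesis by (auto intro: reach_sym)
qed

lemma reach_cycle:
  assumes "x \<in> set vs" "y \<in> set vs"
  shows "reach (cycle_edges vs) x y"
proof -
  have "reach (cycle_edges vs) (vs ! 0) (vs ! i)" if "i < length vs" for i
    using that
  proof (induction i)
    case (Suc i)
    then have "cycle_edge vs i = {vs ! i, vs ! Suc i}" by (simp add: cycle_edge_def)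
    then have "{vs ! i, vs ! Suc i} \<in> cycle_edges vs"
      using Suc.prems by (auto simp: cycle_edges_conv intro!: image_eqI[where x = i])
    then show ?case using Suc by (auto intro: reach_trans reach_edge)
  qed auto
  then show ?thesis using assms by (metis in_set_conv_nth reach_sym reach_trans)
qed

lemma is_cycleE:
  assumes "is_cycle E C"
  obtains vs where "distinct vs" "length vs \<ge> 3" "C = cycle_edges vs" "C \<subseteq> E"
  using assms unfolding is_cycle_def by blast

lemma is_cycle_mono: "is_cycle E C \<Longrightarrow> E \<subseteq> F \<Longrightarrow> is_cycle F C"
  unfolding is_cycle_def by blast

lemma is_cycle_subset: "is_cycle E C \<Longrightarrow> C \<subseteq> E"
  unfolding is_cycle_def by blast

lemma is_cycle_restrict: "is_cycle E C \<Longrightarrow> C \<subseteq> F \<Longrightarrow> is_cycle F C"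
  unfolding is_cycle_def by blast

lemma is_cycle_finite: "is_cycle E C \<Longrightarrow> finite C"
  by (auto elim!: is_cycleE simp: cycle_edges_def)

lemma deg_is_cycle: "is_cycle E C \<Longrightarrow> v \<in> \<Union> C \<Longrightarrow> deg C v = 2"
  by (metis Union_cycle_edges deg_cycle_edges is_cycleE)

text \<open>A vertex of \<open>D\<close> has degree 2 in both cycles, so \<open>D\<close> contains
  all edges of \<open>C\<close> at it. The vertices of \<open>D\<close> are thus closed under the
  edges of the connected \<open>C\<close>.\<close>

lemma is_cycle_subset_eq:
  assumes "is_cycle E C" "is_cycle E D" "D \<subseteq> C"
  shows "D = C"
proof -
  obtain vs where vs: "distinct vs" "length vs \<ge> 3" "C = cycle_edges vs" using assms(1) is_cycleE by metis
  obtain x where x: "x \<in> \<Union> D"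
    using assms(2) unfolding is_cycle_def by (metis Union_cycle_edges ex_in_conv le_zero_eq list.size(3) set_empty zero_neq_numeral)
  have star: "{e \<in> D. v \<in> e} = {e \<in> C. v \<in> e}" if "v \<in> \<Union> D" for v
  proof (rule card_subset_eq)
    show "finite {e \<in> C. v \<in> e}" using is_cycle_finite[OF assms(1)] by simp
    show "card {e \<in> D. v \<in> e} = card {e \<in> C. v \<in> e}"
      using deg_is_cycle[OF assms(1), of v] deg_is_cycle[OF assms(2) that] that assms(3)
      unfolding deg_def by (metis Union_mono subsetD)
  qed (use assms(3) in auto)
  have all: "y \<in> \<Union> D" if "y \<in> \<Union> C" for y
  proof (rule reach_closed[of C x y])
    show "reach C x y" using reach_cycle x that assms(3) vs(3) by (metis Union_cycle_edges Union_mono subsetD)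
    show "b \<in> \<Union> D" if "{a, b} \<in> C" "a \<in> \<Union> D" for a b
      using star[OF that(2)] that(1) by blast
  qed (use x in auto)
  have "C \<subseteq> D"
  proof
    fix e assume e: "e \<in> C"
    then obtain v where "v \<in> e" using vs(3) by (auto simp: cycle_edges_conv cycle_edge_def)
    then show "e \<in> D" using star[of v] all e by blast
  qed
  with assms(3) show ?thesis by blast
qed

text \<open>A path from \<open>x\<close> to \<open>y\<close> avoiding the edge has at least three
  vertices, and the edge closes it to a cycle.\<close>

lemma ex_cycle_through_edge:
  assumes "{x, y} \<in> E" "x \<noteq> y" "reach (E - {{x, y}}) x y"
  obtains C where "is_cycle E C" "{x, y} \<in> C"
proof -
  obtain p where p: "distinct p" "p \<noteq> []" "hd p = x" "last p = y"
    "successively (\<lambda>a b. {a, b} \<in> E - {{x, y}}) p" using reach_path[OF assms(3)] .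
  have len: "length p \<ge> 3"
  proof (rule ccontr)
    assume "\<not> length p \<ge> 3"
    then have "length p = 0 \<or> length p = 1 \<or> length p = 2" by linarith
    then show False using p assms(2) by (auto simp: length_Suc_conv numeral_2_eq_2)
  qed
  have inner: "cycle_edge p i \<in> E" if "i + 1 < length p" for i
    using p(5) that by (auto simp: successively_conv_nth cycle_edge_def)
  have closing: "cycle_edge p (length p - 1) = {x, y}"
    using p len by (auto simp: cycle_edge_def hd_conv_nth last_conv_nth insert_commute)
  have "cycle_edge p i \<in> E" if "i < length p" for i
    using inner[of i] closing assms(1) that by (cases "i = length p - 1") auto
  then have "is_cycle E (cycle_edges p)"
    unfolding is_cycle_def using p(1) len by (auto simp: cycle_edges_conv)
  moreover have "{x, y} \<in> cycle_edges p"
    unfolding cycle_edges_conv closing[symmetric] using p(2) by (intro imageI) auto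
  ultimately show ?thesis using that by blast
qed

section \<open>Necessity\<close>

text \<open>In a connected simple graph the remaining edges of \<open>E\<close> are the
  bridges.\<close>

definition cyclic_edges :: "nat set set \<Rightarrow> nat set set" where
  "cyclic_edges E = \<Union> {C. is_cycle E C}"

lemma cyclic_edges_subset: "cyclic_edges E \<subseteq> E"
  unfolding cyclic_edges_def by (auto dest: is_cycle_subset)

lemma bridge_if_not_cyclic:
  "{x, y} \<in> E - cyclic_edges E \<Longrightarrow> x \<noteq> y \<Longrightarrow> \<not> reach (E - {{x, y}}) x y"
  unfolding cyclic_edges_def using ex_cycle_through_edge[of x y E] by blast

lemma finite_cycles: "finite E \<Longrightarrow> finite {C. is_cycle E C}"
  by (rule finite_subset[of _ "Pow E"]) (auto dest: is_cycle_subset)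

lemma cycle_nonempty: "is_cycle E C \<Longrightarrow> C \<noteq> {}"
  by (auto elim!: is_cycleE simp: cycle_edges_def)

lemma cactus_cycles_disjoint:
  assumes "cactus V E" "is_cycle E C" "is_cycle E D" "C \<noteq> D"
  shows "C \<inter> D = {}"
  using assms is_cycle_subset[OF assms(2)] unfolding cactus_def by blast

text \<open>Cycles of a cactus are edge-disjoint, so the cyclic edges at \<open>v\<close> split into
  pairs, one for each cycle through \<open>v\<close>.\<close>

lemma even_deg_cyclic_edges:
  assumes "cactus V E" "finite V"
  shows "even (deg (cyclic_edges E) v)"
proof -
  let ?F = "{C. is_cycle E C \<and> v \<in> \<Union> C}"
  have fin: "finite ?F"
    using finite_cycles simple_graph_finite assms
    by (auto simp: cactus_def intro: finite_subset[of _ "{C. is_cycle E C}"])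
  have "{e \<in> cyclic_edges E. v \<in> e} = (\<Union>C\<in>?F. {e \<in> C. v \<in> e})"
    unfolding cyclic_edges_def by auto
  moreover have "card (\<Union>C\<in>?F. {e \<in> C. v \<in> e}) = (\<Sum>C\<in>?F. card {e \<in> C. v \<in> e})"
  proof (rule card_UN_disjoint)
    show "\<forall>C\<in>?F. \<forall>D\<in>?F. C \<noteq> D \<longrightarrow> {e \<in> C. v \<in> e} \<inter> {e \<in> D. v \<in> e} = {}"
      using cactus_cycles_disjoint[OF assms(1)] by blast
  qed (use fin in \<open>auto dest: is_cycle_finite\<close>)
  moreover have "(\<Sum>C\<in>?F. card {e \<in> C. v \<in> e}) = (\<Sum>C\<in>?F. 2)"
    using deg_is_cycle unfolding deg_def by (intro sum.cong) auto
  ultimately show ?thesis unfolding deg_def by simp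
qed

lemma card_Collect_eq_sum:
  "finite A \<Longrightarrow> card {x \<in> A. P x} = (\<Sum>x\<in>A. of_bool (P x))"
  by (simp add: Int_def)

lemma sum_deg:
  assumes "finite V" "simple_graph V E"
  shows "(\<Sum>v\<in>V. deg E v) = 2 * card E"
proof -
  have fin: "finite E" using assms simple_graph_finite by blast
  have "(\<Sum>v\<in>V. deg E v) = (\<Sum>v\<in>V. \<Sum>e\<in>E. of_bool (v \<in> e))"
    unfolding deg_def using fin by (simp only: card_Collect_eq_sum)
  also have "\<dots> = (\<Sum>e\<in>E. \<Sum>v\<in>V. of_bool (v \<in> e))" by (rule sum.swap)
  also have "\<dots> = (\<Sum>e\<in>E. 2)"
  proof (rule sum.cong)
    fix e assume "e \<in> E"
    then have "e \<subseteq> V" "card e = 2" using assms(2) by (auto simp: simple_graph_def)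
    then show "(\<Sum>v\<in>V. of_bool (v \<in> e)) = (2 :: nat)"
      using assms(1) by (simp add: inf.absorb2)
  qed simp
  finally show ?thesis by simp
qed

lemma simple_graph_subset: "simple_graph V E \<Longrightarrow> F \<subseteq> E \<Longrightarrow> simple_graph V F"
  unfolding simple_graph_def by blast

text \<open>Deleting one edge from each cycle leaves a spanning tree.\<close>

lemma cactus_card_edges_le:
  assumes cac: "cactus V E" and V: "finite V" "V \<noteq> {}"
  shows "card E + 1 \<le> card V + card {C. is_cycle E C}"
proof -
  have E: "simple_graph V E" "connected_graph V E" using cac by (auto simp: cactus_def)
  then have fin: "finite E" using simple_graph_finite V by blast
  obtain h where h: "\<And>C. is_cycle E C \<Longrightarrow> h C \<in> C"
    using cycle_nonempty by (metis ex_in_conv)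
  define F where "F = E - h ` {C. is_cycle E C}"
  have sF: "simple_graph V F" using E(1) by (rule simple_graph_subset) (auto simp: F_def)
  have "reach F a b" if "{a, b} \<in> E" for a b
  proof (cases "{a, b} \<in> F")
    case True
    then show ?thesis by (rule reach_edge)
  next
    case False
    then obtain C where C: "is_cycle E C" "h C = {a, b}" using \<open>{a, b} \<in> E\<close> by (auto simp: F_def)
    then obtain vs where vs: "distinct vs" "length vs \<ge> 3" "C = cycle_edges vs"
      using is_cycleE by metis
    \<comment> \<open>By disjointness no other cycle has its deleted edge on \<open>C\<close>, so
      the rest of \<open>C\<close> still joins \<open>a\<close> and \<open>b\<close>.\<close>
    have "C - {{a, b}} \<subseteq> F"
    proof
      fix e assume e: "e \<in> C - {{a, b}}"
      have "e \<noteq> h D" if "is_cycle E D" for D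
        using cactus_cycles_disjoint[OF cac C(1) that] h[OF that] e C(2) by auto
      then show "e \<in> F" using e is_cycle_subset[OF C(1)] by (auto simp: F_def)
    qed
    moreover have "reach (C - {{a, b}}) a b"
      using reach_cycle_minus_edge[OF vs(1,2)] h[OF C(1)] C(2) vs(3) by simp
    ultimately show ?thesis using reach_mono by blast
  qed
  then have cF: "connected_graph V F"
    using E(2) reach_replace[of E _ _ F] unfolding connected_graph_def by blast
  obtain r where r: "r \<in> V" using V by blast
  have "card F + card {r} \<le> card V"
  proof (rule card_cut_edges_le[OF V(1) sF cF])
    \<comment> \<open>\<open>F\<close> contains no cycle, so each of its edges separates its ends,
      and one of them loses contact with the root \<open>r\<close>.\<close>
    fix e assume e: "e \<in> F"
    obtain x y where xy: "e = {x, y}" "x \<noteq> y" using edge_ends[OF sF e] by metis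
    have "\<not> reach (F - {e}) x y"
    proof
      assume "reach (F - {e}) x y"
      then obtain C where C: "is_cycle F C" using ex_cycle_through_edge[of x y F] xy e by blast
      then have "is_cycle E C" by (rule is_cycle_mono) (auto simp: F_def)
      then have "h C \<in> C" "h C \<notin> F" using h by (auto simp: F_def)
      then show False using is_cycle_subset[OF C] by blast
    qed
    then have "\<not> reach (F - {e}) x r \<or> \<not> reach (F - {e}) y r"
      using reach_trans[OF _ reach_sym] by metis
    then show "\<exists>b\<in>e. \<forall>s\<in>{r}. \<not> reach (F - {e}) b s" using xy by auto
  qed (use r in auto)
  moreover have "card E - card (h ` {C. is_cycle E C}) \<le> card F"
    unfolding F_def by (rule diff_card_le_card_Diff) (use finite_cycles fin in auto)
  moreover have "card (h ` {C. is_cycle E C}) \<le> card {C. is_cycle E C}"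
    by (rule card_image_le) (use finite_cycles fin in auto)
  ultimately show ?thesis by simp
qed

text \<open>Removing an edge on no cycle keeps all cycles. If both its ends still reached cycles, it
  would be a bridge with a cycle on each side; hence one end is cut off from every vertex on a
  cycle.\<close>

lemma core_cactus_card_bridges_le:
  assumes core: "core_cactus V E" and V: "finite V" and K: "cyclic_edges E \<noteq> {}"
  shows "card (E - cyclic_edges E) + card (\<Union> (cyclic_edges E)) \<le> card V"
proof -
  have E: "simple_graph V E" "connected_graph V E"
    using core by (auto simp: core_cactus_def cactus_def)
  show ?thesis
  proof (rule card_cut_edges_le[OF V E])
    show "\<Union> (cyclic_edges E) \<subseteq> V"
      using E(1) cyclic_edges_subset unfolding simple_graph_def by blast
    show "\<Union> (cyclic_edges E) \<noteq> {}"
    proof -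
      obtain e where "e \<in> cyclic_edges E" using K by blast
      then have "e \<in> cyclic_edges E" "e \<noteq> {}"
        using cyclic_edges_subset[of E] E(1) unfolding simple_graph_def by fastforce+
      then show ?thesis by blast
    qed
  next
    fix e assume e: "e \<in> E - cyclic_edges E"
    obtain x y where xy: "e = {x, y}" "x \<noteq> y" "x \<in> V" "y \<in> V"
      using edge_ends[OF E(1)] e by (metis DiffD1)
    have nr: "\<not> reach (E - {e}) x y" using bridge_if_not_cyclic e xy by blast
    then have br: "bridge V E e"
      using e xy unfolding bridge_def connected_graph_def by blast
    have cyc: "is_cycle (E - {e}) C" if "is_cycle E C" for C
      using is_cycle_restrict[OF that, of "E - {e}"] is_cycle_subset[OF that] e that
      unfolding cyclic_edges_def by blast
    show "\<exists>b\<in>e. \<forall>s\<in>\<Union> (cyclic_edges E). \<not> reach (E - {e}) b s"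
    proof (rule ccontr)
      assume "\<not> ?thesis"
      then obtain s t where st: "s \<in> \<Union> (cyclic_edges E)" "t \<in> \<Union> (cyclic_edges E)"
        "reach (E - {e}) x s" "reach (E - {e}) y t" using xy(1) by blast
      obtain C D where CD: "is_cycle E C" "is_cycle E D" "s \<in> \<Union> C" "t \<in> \<Union> D"
        using st(1,2) unfolding cyclic_edges_def by blast
      have "reach (E - {e}) s t"
        using core br cyc CD unfolding core_cactus_def by blast
      then show False using nr st(3,4) reach_trans reach_sym by metis
    qed
  qed auto
qed

lemma bipartite_cycle_card:
  assumes "bipartite E" "is_cycle E C"
  shows "card C \<ge> 4"
proof (rule ccontr)
  assume *: "\<not> card C \<ge> 4"
  obtain vs where vs: "distinct vs" "length vs \<ge> 3" "C = cycle_edges vs" "C \<subseteq> E"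
    using is_cycleE[OF assms(2)] .
  then have len: "length vs = 3" using * card_cycle_edges by fastforce
  obtain f :: "nat \<Rightarrow> bool" where f: "\<And>u v. {u, v} \<in> E \<Longrightarrow> f u \<noteq> f v"
    using assms(1) unfolding bipartite_def by blast
  have "f (vs ! i) \<noteq> f (vs ! ((i + 1) mod 3))" if "i < 3" for i
    using f vs(3,4) len that by (auto simp: cycle_edges_conv cycle_edge_def)
  from this[of 0] this[of 1] this[of 2] show False
    by (auto simp: numeral_2_eq_2)
qed

lemma connected_deg_pos:
  assumes "connected_graph V E" "finite E" "v \<in> V" "w \<in> V" "v \<noteq> w"
  shows "deg E v > 0"
proof -
  have "reach E v w" using assms by (auto simp: connected_graph_def)
  then obtain a where "{v, a} \<in> E" using reach_last_departure assms(5) by metis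
  then have "{v, a} \<in> {e \<in> E. v \<in> e}" by simp
  then show ?thesis unfolding deg_def using assms(2) by (auto simp: card_gt_0_iff)
qed

text \<open>Each leaf is sent to its only edge. Two leaves sharing an edge would form a whole
  component, impossible in a connected graph on three or more vertices.\<close>

lemma card_leaves_le:
  assumes conn: "connected_graph V E" "simple_graph V E" and V: "finite V" "card V \<ge> 3"
    and B: "\<And>e v. e \<in> E \<Longrightarrow> v \<in> e \<Longrightarrow> deg E v = 1 \<Longrightarrow> e \<in> B" and fin: "finite B"
  shows "card {v \<in> V. deg E v = 1} \<le> card B"
proof -
  have "\<exists>e. {f \<in> E. v \<in> f} = {e}" if "deg E v = 1" for v
    using that unfolding deg_def by (simp add: card_1_singleton_iff)
  then obtain g where g: "\<And>v. deg E v = 1 \<Longrightarrow> {f \<in> E. v \<in> f} = {g v}" by metis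
  then have g': "g v \<in> E" "v \<in> g v" if "deg E v = 1" for v using that by blast+
  show ?thesis
  proof (rule card_inj_on_le)
    show "g ` {v \<in> V. deg E v = 1} \<subseteq> B" using B g' by auto
    show "inj_on g {v \<in> V. deg E v = 1}"
    proof (rule inj_onI, rule ccontr)
      fix u v assume uv: "u \<in> {v \<in> V. deg E v = 1}" "v \<in> {v \<in> V. deg E v = 1}" "g u = g v" "u \<noteq> v"
      have "u \<in> g u" "v \<in> g u" "card (g u) = 2"
        using uv g' conn(2) unfolding simple_graph_def by auto
      then have gu: "g u = {u, v}" using uv(4) by (auto simp: card_2_iff)
      have "w \<in> {u, v}" if "w \<in> V" for w
      proof (rule reach_closed[of E u])
        show "reach E u w" using conn uv that by (auto simp: connected_graph_def)
        fix a b assume ab: "{a, b} \<in> E" "a \<in> {u, v}"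
        then have "{a, b} \<in> {f \<in> E. a \<in> f}" by simp
        moreover have "{f \<in> E. a \<in> f} = {{u, v}}"
          using ab(2) g[of u] g[of v] gu uv by (metis (mono_tags) insertE mem_Collect_eq singletonD)
        ultimately have "{a, b} = {u, v}" by simp
        then show "b \<in> {u, v}" by auto
      qed simp
      then have "card V \<le> card {u, v}" by (intro card_mono) auto
      then show False using V uv(4) by simp
    qed
  qed (rule fin)
qed

lemma core_bi_cactus_necessary:
  assumes cbc: "core_bi_cactus V E" and V: "finite V" "card V \<ge> 3" and E: "card E \<ge> card V"
  shows "card {v \<in> V. odd (deg E v) \<and> deg E v > 1} \<le> card {v \<in> V. deg E v = 1}"
    and "3 * card E + card {v \<in> V. deg E v = 1} + 4 \<le> 4 * card V"
proof -
  have core: "core_cactus V E" and bip: "bipartite E" and cac: "cactus V E"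
    and simp: "simple_graph V E" and conn: "connected_graph V E"
    using cbc by (auto simp: core_bi_cactus_def core_cactus_def cactus_def)
  have fin: "finite E" using simple_graph_finite simp V by blast
  define Y where "Y = {C. is_cycle E C}"
  define B where "B = E - cyclic_edges E"
  define K where "K = \<Union> (cyclic_edges E)"
  have finY: "finite Y" unfolding Y_def using fin by (rule finite_cycles)
  have rank: "card E + 1 \<le> card V + card Y"
    unfolding Y_def using cac V by (intro cactus_card_edges_le) auto
  then have "Y \<noteq> {}" using E by auto
  then have ne: "cyclic_edges E \<noteq> {}"
    unfolding cyclic_edges_def Y_def using cycle_nonempty by auto
  have BK: "card B + card K \<le> card V"
    unfolding B_def K_def by (rule core_cactus_card_bridges_le[OF core V(1) ne])
  have KV: "K \<subseteq> V" unfolding K_def using simp cyclic_edges_subset unfolding simple_graph_def by blast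
  have deg: "deg E v = deg (cyclic_edges E) v + deg B v" for v
  proof -
    have "{e \<in> E. v \<in> e} = {e \<in> cyclic_edges E. v \<in> e} \<union> {e \<in> B. v \<in> e}"
      using cyclic_edges_subset unfolding B_def by blast
    moreover have "card \<dots> = card {e \<in> cyclic_edges E. v \<in> e} + card {e \<in> B. v \<in> e}"
      by (rule card_Un_disjoint)
        (use fin finite_subset[OF cyclic_edges_subset fin] in \<open>auto simp: B_def\<close>)
    ultimately show ?thesis by (simp add: deg_def)
  qed
  have degK: "deg E v \<ge> 2" if v: "v \<in> K" for v
  proof -
    obtain C where C: "is_cycle E C" "v \<in> \<Union> C" using v unfolding K_def cyclic_edges_def by blast
    have "deg C v \<le> deg E v"
      unfolding deg_def by (rule card_mono) (use fin is_cycle_subset[OF C(1)] in auto)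
    then show ?thesis using deg_is_cycle[OF C] by simp
  qed
  have finB: "finite B" using fin by (simp add: B_def)
  have leaves: "card {v \<in> V. deg E v = 1} \<le> card B"
  proof (rule card_leaves_le[OF conn simp V])
    fix e v assume "e \<in> E" "v \<in> e" "deg E v = 1"
    then show "e \<in> B" using degK[of v] unfolding B_def K_def by auto
  qed (rule finB)
  have "card (cyclic_edges E) = (\<Sum>C\<in>Y. card C)"
    unfolding cyclic_edges_def Y_def[symmetric]
    by (rule card_Union_disjoint)
      (auto simp: Y_def pairwise_def disjnt_def cactus_cycles_disjoint[OF cac] is_cycle_finite)
  moreover have "(\<Sum>C\<in>Y. 4) \<le> (\<Sum>C\<in>Y. card C)"
    by (rule sum_mono) (auto simp: Y_def bipartite_cycle_card[OF bip])
  ultimately have "4 * card Y \<le> card (cyclic_edges E)" by simp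
  moreover have "card E = card B + card (cyclic_edges E)"
    using card_Diff_subset[OF finite_subset[OF cyclic_edges_subset fin] cyclic_edges_subset]
      card_mono[OF fin cyclic_edges_subset] unfolding B_def by simp
  \<comment> \<open>With \<open>m\<close> edges, \<open>n\<close> vertices and \<open>l\<close>
    leaves: \<open>m >= l + 4 * card Y\<close> and \<open>card Y >= m - n + 1\<close>.\<close>
  ultimately show "3 * card E + card {v \<in> V. deg E v = 1} + 4 \<le> 4 * card V"
    using rank leaves by linarith

  let ?a = "\<lambda>v. of_bool (odd (deg E v) \<and> deg E v > 1) :: nat"
  let ?l = "\<lambda>v. of_bool (deg E v = 1) :: nat"
  \<comment> \<open>An odd degree needs an edge of \<open>B\<close>, since the cyclic edges
    contribute an even number.\<close>
  have "?a v \<le> deg B v + ?l v" for v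
    using even_deg_cyclic_edges[OF cac V(1), of v] deg[of v]
    by (cases "deg B v = 0") auto
  then have onK: "(\<Sum>v\<in>K. ?a v) \<le> (\<Sum>v\<in>K. deg B v + ?l v)" by (intro sum_mono)
  \<comment> \<open>Off the cycles all edges at \<open>v\<close> lie in \<open>B\<close>, and
    degrees 1, 2 and at least 3 each leave room for the extra 2. This surplus pays for the edges of
    \<open>B\<close>, whose number is at most \<open>card (V - K)\<close>.\<close>
  have "(\<Sum>v\<in>V-K. ?a v + 2) \<le> (\<Sum>v\<in>V-K. deg B v + ?l v)"
  proof (rule sum_mono)
    fix v assume v: "v \<in> V - K"
    then have "{e \<in> cyclic_edges E. v \<in> e} = {}" unfolding K_def by auto
    then have "deg E v = deg B v" using deg[of v] by (simp only: deg_def) simp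
    moreover have "deg E v > 0"
    proof -
      have "V \<noteq> {v}" using V(2) by auto
      then obtain w where "w \<in> V" "v \<noteq> w" using v by blast
      then show ?thesis using connected_deg_pos[OF conn fin] v by blast
    qed
    ultimately show "?a v + 2 \<le> deg B v + ?l v" by (cases "deg E v = 2") auto
  qed
  then have offK: "(\<Sum>v\<in>V-K. ?a v) + 2 * card (V - K) \<le> (\<Sum>v\<in>V-K. deg B v + ?l v)"
    unfolding sum.distrib by simp
  have split: "sum f V = sum f K + sum f (V - K)" for f :: "nat \<Rightarrow> nat"
    using sum.subset_diff[OF KV V(1), of f] by simp
  have "(\<Sum>v\<in>V. ?a v) + 2 * card (V - K) \<le> (\<Sum>v\<in>V. deg B v + ?l v)"
    unfolding split using onK offK by linarith
  also have "\<dots> = 2 * card B + (\<Sum>v\<in>V. ?l v)"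
    using sum_deg[OF V(1) simple_graph_subset[OF simp, of B]] by (simp add: sum.distrib B_def)
  also have "card B \<le> card (V - K)"
    using BK KV V(1) by (simp add: card_Diff_subset finite_subset)
  finally have "(\<Sum>v\<in>V. ?a v) \<le> (\<Sum>v\<in>V. ?l v)" by simp
  then show "card {v \<in> V. odd (deg E v) \<and> deg E v > 1} \<le> card {v \<in> V. deg E v = 1}"
    using V(1) by (simp only: card_Collect_eq_sum)
qed

section \<open>Sufficiency\<close>

lemma cycle_edges_card_2:
  assumes "distinct vs" "length vs \<ge> 3" "e \<in> cycle_edges vs"
  shows "card e = 2"
proof -
  obtain i where i: "i < length vs" "e = cycle_edge vs i" using assms(3) by (auto simp: cycle_edges_conv)
  have "vs ! i \<noteq> vs ! ((i + 1) mod length vs)"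
    using cyclic_succ_nth_eq[of vs i i] Suc_mod_less[of i "length vs"] i assms(1,2)
    by (auto split: if_splits)
  then show ?thesis unfolding i(2) cycle_edge_def by simp
qed

text \<open>Vertices are coloured by the parity of their position; since the length is even, the
  wrap-around edge joins an odd position to 0.\<close>

lemma even_cycle_bipartite:
  assumes "distinct vs" "even (length vs)"
  shows "bipartite (cycle_edges vs)"
  unfolding bipartite_def
proof (intro exI allI impI)
  let ?g = "\<lambda>x. \<exists>i<length vs. even i \<and> vs ! i = x"
  have g: "?g (vs ! i) = even i" if "i < length vs" for i
    using assms(1) that by (auto simp: nth_eq_iff_index_eq)
  fix a b assume "{a, b} \<in> cycle_edges vs"
  then obtain i where i: "i < length vs" "{a, b} = cycle_edge vs i" by (auto simp: cycle_edges_conv)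
  have less: "(i + 1) mod length vs < length vs" using i by (intro mod_less_divisor) auto
  have "even i \<noteq> even ((i + 1) mod length vs)"
  proof (cases "i + 1 = length vs")
    case True
    then have "odd i" using assms(2) by presburger
    then show ?thesis using True by simp
  qed (use i(1) in auto)
  then have "?g (vs ! i) \<noteq> ?g (vs ! ((i + 1) mod length vs))"
    using g[OF i(1)] g[OF less] by simp
  moreover have "a = vs ! i \<and> b = vs ! ((i + 1) mod length vs) \<or> b = vs ! i \<and> a = vs ! ((i + 1) mod length vs)"
    using i(2) unfolding cycle_edge_def by (auto simp: doubleton_eq_iff)
  ultimately show "?g a \<noteq> ?g b" by metis
qed

lemma deg_outside: "simple_graph V E \<Longrightarrow> v \<notin> V \<Longrightarrow> deg E v = 0"
proof -
  assume "simple_graph V E" "v \<notin> V"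
  then have "{e \<in> E. v \<in> e} = {}" unfolding simple_graph_def by blast
  then show ?thesis unfolding deg_def by (simp only: card.empty)
qed

lemma deg_Un_disjoint:
  assumes "finite E" "finite F" "E \<inter> F = {}"
  shows "deg (E \<union> F) v = deg E v + deg F v"
proof -
  have "{e \<in> E \<union> F. v \<in> e} = {e \<in> E. v \<in> e} \<union> {e \<in> F. v \<in> e}" by blast
  moreover have "card \<dots> = card {e \<in> E. v \<in> e} + card {e \<in> F. v \<in> e}"
    by (rule card_Un_disjoint) (use assms in auto)
  ultimately show ?thesis unfolding deg_def by simp
qed

lemma connected_graph_rooted:
  assumes "\<And>v. v \<in> V \<Longrightarrow> reach E u v"
  shows "connected_graph V E"
  unfolding connected_graph_def using assms reach_trans reach_sym by metis

lemma simple_graph_edgeD: "simple_graph V E \<Longrightarrow> {a, b} \<in> E \<Longrightarrow> a \<in> V \<and> b \<in> V"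
  unfolding simple_graph_def by blast

section \<open>Attaching an even cycle to a bipartite cactus at one vertex\<close>

text \<open>Together with \<open>u\<close>, an odd number of fresh vertices gives a cycle of even
  length that meets the old graph only in \<open>u\<close>.\<close>

locale cycle_attachment =
  fixes V :: "nat set" and E :: "nat set set" and u :: nat and ws :: "nat list"
  assumes cactus: "cactus V E" and bipartite: "bipartite E" and fin: "finite V"
    and u: "u \<in> V" and dist: "distinct ws" and fresh: "set ws \<inter> V = {}"
    and len: "odd (length ws)" "length ws \<ge> 3"
begin

abbreviation "vs \<equiv> u # ws"
abbreviation "D \<equiv> cycle_edges vs"

lemma vs: "distinct vs" "length vs \<ge> 3"
  using dist fresh u len by auto

lemma simple: "simple_graph V E" and conn: "connected_graph V E"
  using cactus by (auto simp: cactus_def)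

lemma D_meets_ws:
  assumes "e \<in> D"
  shows "\<exists>w\<in>set ws. w \<in> e"
proof -
  obtain i where i: "i < length vs" "e = cycle_edge vs i" using assms by (auto simp: cycle_edges_conv)
  show ?thesis
  proof (cases i)
    case 0
    have "(0 + 1) mod length vs = 1" using Suc_mod_less[of 0 "length vs"] vs(2) by auto
    then have "vs ! 1 \<in> e" using i(2) 0 unfolding cycle_edge_def by (metis insertI1 insert_commute)
    moreover have "vs ! 1 \<in> set ws" using len by (auto intro: nth_mem)
    ultimately show ?thesis by blast
  next
    case (Suc j)
    then have "vs ! i \<in> set ws" using i(1) by simp
    moreover have "vs ! i \<in> e" using i(2) by (simp add: cycle_edge_def)
    ultimately show ?thesis by blast
  qed
qed

lemma disj: "E \<inter> D = {}"
  using D_meets_ws fresh simple unfolding simple_graph_def by blast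

lemma cycle_D: "is_cycle (E \<union> D) D"
  unfolding is_cycle_def using vs by blast

lemma fin_edges: "finite E" "finite D"
  using simple_graph_finite[OF simple fin] by (simp_all add: cycle_edges_def)

text \<open>A fresh vertex has only two edges, so a cycle through one of them runs along all of \<^term>\<open>D\<close>.\<close>

lemma new_cycle:
  assumes C: "is_cycle (E \<union> D) C"
  shows "is_cycle E C \<or> C = D"
proof (cases "C \<subseteq> E")
  case True
  then show ?thesis using is_cycle_restrict[OF C] by blast
next
  case False
  have star: "{e \<in> C. w \<in> e} = {e \<in> D. w \<in> e}" if "w \<in> set ws" "w \<in> \<Union> C" for w
  proof (rule card_subset_eq)
    have "w \<notin> V" using fresh that by blast
    then show "{e \<in> C. w \<in> e} \<subseteq> {e \<in> D. w \<in> e}"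
      using is_cycle_subset[OF C] simple unfolding simple_graph_def by blast
    have "w \<in> set vs" using that by simp
    then show "card {e \<in> C. w \<in> e} = card {e \<in> D. w \<in> e}"
      using deg_is_cycle[OF C that(2)] deg_cycle_edges[OF vs] unfolding deg_def by presburger
  qed (use fin_edges in auto)
  \<comment> \<open>Consecutive edges meet in a fresh vertex, since only position 0 holds
    \<open>u\<close>; membership in \<open>C\<close> therefore propagates along the whole
    list.\<close>
  have step: "cycle_edge vs i \<in> C \<longleftrightarrow> cycle_edge vs (Suc i) \<in> C" if "Suc i < length vs" for i
  proof -
    have w: "vs ! Suc i \<in> set ws" using that by simp
    have "cycle_edge vs i \<in> D" "cycle_edge vs (Suc i) \<in> D"
      using that by (auto simp: cycle_edges_conv)
    moreover have "vs ! Suc i \<in> cycle_edge vs i" "vs ! Suc i \<in> cycle_edge vs (Suc i)"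
      using that by (auto simp: cycle_edge_def)
    ultimately show ?thesis using star[OF w] by blast
  qed
  have all: "cycle_edge vs i \<in> C \<longleftrightarrow> cycle_edge vs 0 \<in> C" if "i < length vs" for i
    using that by (induction i) (use step in auto)
  obtain e where "e \<in> C" "e \<in> D" using False is_cycle_subset[OF C] by blast
  then obtain i where "i < length vs" "cycle_edge vs i \<in> C" unfolding cycle_edges_conv by blast
  then have "cycle_edge vs 0 \<in> C" using all by blast
  then have "D \<subseteq> C" using all unfolding cycle_edges_conv by blast
  then show ?thesis using is_cycle_subset_eq[OF C cycle_D] by blast
qed

lemma cactus_attach: "cactus (V \<union> set ws) (E \<union> D)"
proof -
  have "simple_graph (V \<union> set ws) (E \<union> D)"
  proof -
    have "e \<subseteq> V \<union> set ws" if "e \<in> D" for e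
      using Union_upper[OF that] u by auto
    then show ?thesis
      using simple cycle_edges_card_2[OF vs] unfolding simple_graph_def by auto
  qed
  moreover have "connected_graph (V \<union> set ws) (E \<union> D)"
  proof (rule connected_graph_rooted)
    fix v assume "v \<in> V \<union> set ws"
    then consider "v \<in> V" | "v \<in> set vs" by auto
    then show "reach (E \<union> D) u v"
    proof cases
      case 1
      then have "reach E u v" using conn u by (auto simp: connected_graph_def)
      then show ?thesis by (rule reach_mono) auto
    next
      case 2
      then have "reach D u v" by (intro reach_cycle) auto
      then show ?thesis by (rule reach_mono) auto
    qed
  qed
  moreover have "C1 = C2"
    if C: "is_cycle (E \<union> D) C1" "is_cycle (E \<union> D) C2" "e \<in> C1" "e \<in> C2" for e C1 C2
  \<comment> \<open>An edge of \<open>D\<close> lies on no old cycle, hence only on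
    \<open>D\<close>; any other edge lies only on old cycles.\<close>
  proof (cases "e \<in> D")
    case True
    then have "\<not> is_cycle E C" if "e \<in> C" for C
      using is_cycle_subset[of E C] disj that by blast
    then show ?thesis using new_cycle C by metis
  next
    case False
    then have "is_cycle E C1" "is_cycle E C2" using new_cycle C by metis+
    then show ?thesis using cactus_cycles_disjoint[OF cactus] C(3,4) by blast
  qed
  ultimately show ?thesis unfolding cactus_def by blast
qed

lemma bipartite_attach: "bipartite (E \<union> D)"
proof -
  obtain f :: "nat \<Rightarrow> bool" where f: "\<And>a b. {a, b} \<in> E \<Longrightarrow> f a \<noteq> f b"
    using bipartite unfolding bipartite_def by blast
  obtain g0 :: "nat \<Rightarrow> bool" where g0: "\<And>a b. {a, b} \<in> D \<Longrightarrow> g0 a \<noteq> g0 b"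
    using even_cycle_bipartite[OF vs(1)] len unfolding bipartite_def by auto
  \<comment> \<open>The colouring of \<open>D\<close>, with colours swapped if necessary to agree
    with \<open>f\<close> at \<open>u\<close>.\<close>
  define g where "g x = (g0 x = (g0 u = f u))" for x
  have g: "g u = f u" "\<And>a b. {a, b} \<in> D \<Longrightarrow> g a \<noteq> g b" using g0 unfolding g_def by auto
  define h where "h x = (if x \<in> V then f x else g x)" for x
  have "h a \<noteq> h b" if "{a, b} \<in> E" for a b
    using f[OF that] simple_graph_edgeD[OF simple that] by (auto simp: h_def)
  moreover have "h a \<noteq> h b" if "{a, b} \<in> D" for a b
  proof -
    have hg: "h x = g x" if "x \<in> set vs" for x using that fresh g(1) by (auto simp: h_def)
    have "{a, b} \<subseteq> set vs" using that Union_cycle_edges[of vs] by blast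
    then show ?thesis using hg[of a] hg[of b] g(2)[OF that] by simp
  qed
  ultimately show ?thesis unfolding bipartite_def by (intro exI[of _ h]) auto
qed

lemma cyclic_edges_attach:
  assumes "cyclic_edges E = E"
  shows "cyclic_edges (E \<union> D) = E \<union> D"
proof
  show "cyclic_edges (E \<union> D) \<subseteq> E \<union> D" by (rule cyclic_edges_subset)
  have "cyclic_edges E \<subseteq> cyclic_edges (E \<union> D)"
    unfolding cyclic_edges_def by (auto intro: is_cycle_mono)
  moreover have "D \<subseteq> cyclic_edges (E \<union> D)"
    unfolding cyclic_edges_def using cycle_D by blast
  ultimately show "E \<union> D \<subseteq> cyclic_edges (E \<union> D)" using assms by simp
qed

lemma deg_attach: "deg (E \<union> D) v = deg E v + (if v \<in> insert u (set ws) then 2 else 0)"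
proof -
  have "deg D v = (if v \<in> insert u (set ws) then 2 else 0)"
  proof (cases "v \<in> set vs")
    case True
    then show ?thesis using deg_cycle_edges[OF vs] by simp
  next
    case False
    then have "{e \<in> D. v \<in> e} = {}" using Union_cycle_edges[of vs] by blast
    then show ?thesis using False unfolding deg_def by (simp only: card.empty) simp
  qed
  then show ?thesis using deg_Un_disjoint[OF fin_edges disj] by simp
qed

end

section \<open>Bridgeless bipartite cacti with prescribed even degrees\<close>

text \<open>The total excess over 1 is \<open>c\<close>, so at most \<open>c\<close> elements have a
  value other than 1.\<close>

lemma card_ones:
  fixes r :: "'a \<Rightarrow> nat"
  assumes "finite V" "\<And>v. v \<in> V \<Longrightarrow> r v \<ge> 1" "sum r V = card V + c"
  shows "card V \<le> card {v \<in> V. r v = 1} + c"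
proof -
  have "(\<Sum>v\<in>V. 2) \<le> (\<Sum>v\<in>V. r v + of_bool (r v = 1))"
    by (rule sum_mono) (use assms(2) in force)
  then show ?thesis
    unfolding sum.distrib card_Collect_eq_sum[OF assms(1)] using assms(3) by simp
qed

text \<open>Here \<open>r v\<close> counts the cycles through \<open>v\<close>. The size matches one
  cycle of length \<open>4 + 2 * j\<close> and three new vertices for each of \<open>c\<close>
  attached 4-cycles. In the induction step three vertices with \<open>r = 1\<close> are removed,
  \<open>r\<close> is lowered at some \<open>u\<close> with \<open>r u >= 2\<close>, and the three
  return on a 4-cycle through \<open>u\<close>.\<close>

lemma bridgeless_bi_cactus_exists:
  fixes r :: "nat \<Rightarrow> nat"
  assumes "finite V" "card V = 3 * c + 4 + 2 * j" "\<And>v. v \<in> V \<Longrightarrow> r v \<ge> 1"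
    "sum r V = card V + c"
  shows "\<exists>E. cactus V E \<and> bipartite E \<and> cyclic_edges E = E \<and> (\<forall>v\<in>V. deg E v = 2 * r v)"
  using assms
proof (induction c arbitrary: V r)
  case 0
  have r1: "r v = 1" if "v \<in> V" for v
  proof -
    have "card V \<le> card {v \<in> V. r v = 1}" using card_ones[OF 0(1,3,4)] by simp
    then have "{v \<in> V. r v = 1} = V" using 0(1) by (intro card_seteq) auto
    then show ?thesis using that by blast
  qed
  obtain u where u: "u \<in> V" using 0(2) by fastforce
  obtain ws where ws: "set ws = V - {u}" "distinct ws"
    using finite_distinct_list[of "V - {u}"] 0(1) by auto
  have lw: "length ws = 3 + 2 * j"
    using distinct_card[OF ws(2)] ws(1) u 0(1,2) by simp
  \<comment> \<open>The initial cycle is itself an attachment, to the one-vertex graph.\<close>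
  have "cactus {u} {}"
    unfolding cactus_def simple_graph_def connected_graph_def by auto
  then interpret att: cycle_attachment "{u}" "{}" u ws
  proof unfold_locales
    show "set ws \<inter> {u} = {}" using ws by blast
  qed (use ws lw in \<open>simp_all add: bipartite_def\<close>)
  have V: "{u} \<union> set ws = V" using ws u by blast
  have "cyclic_edges {} = {}" using cyclic_edges_subset by blast
  then show ?case
    using att.cactus_attach att.bipartite_attach att.cyclic_edges_attach att.deg_attach r1
    unfolding V using ws u by (intro exI[of _ "{} \<union> att.D"]) (auto simp: deg_def)
next
  case (Suc c)
  have "\<exists>u\<in>V. r u \<noteq> 1"
  proof (rule ccontr)
    assume "\<not> ?thesis"
    then have "sum r V = card V" by simp
    then show False using Suc.prems(4) by simp
  qed
  then obtain u where u: "u \<in> V" "r u \<ge> 2" using Suc.prems(3) by fastforce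
  have "3 \<le> card {v \<in> V. r v = 1}"
    using card_ones[OF Suc.prems(1,3,4)] Suc.prems(2) by simp
  then obtain W where W: "W \<subseteq> {v \<in> V. r v = 1}" "card W = 3" "finite W"
    by (rule obtain_subset_with_card_n)
  have uW: "u \<notin> W" using W u by auto
  obtain ws where ws: "set ws = W" "distinct ws" using finite_distinct_list W(3) by blast
  have lw: "length ws = 3" using distinct_card[OF ws(2)] ws W by simp
  have cV: "card (V - W) = 3 * c + 4 + 2 * j"
    using W Suc.prems(1,2) by (subst card_Diff_subset) auto
  define r' where "r' = r(u := r u - 1)"
  have "sum r V = sum r (V - W) + sum r W"
    using W Suc.prems(1) by (intro sum.subset_diff) auto
  moreover have "sum r W = 3"
  proof -
    have "sum r W = (\<Sum>v\<in>W. 1)" using W by (intro sum.cong) auto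
    then show ?thesis using W by simp
  qed
  moreover have "sum r (V - W) = sum r' (V - W) + 1"
    using u uW Suc.prems(1) sum.remove[of "V - W" u r] sum.remove[of "V - W" u r']
    by (simp add: r'_def)
  ultimately have s': "sum r' (V - W) = card (V - W) + c"
    using Suc.prems(2,4) cV by simp
  have "\<exists>E. cactus (V - W) E \<and> bipartite E \<and> cyclic_edges E = E \<and> (\<forall>v\<in>V - W. deg E v = 2 * r' v)"
    by (rule Suc.IH) (use Suc.prems u cV s' in \<open>auto simp: r'_def\<close>)
  then obtain E where E: "cactus (V - W) E" "bipartite E" "cyclic_edges E = E"
    "\<And>v. v \<in> V - W \<Longrightarrow> deg E v = 2 * r' v" by blast
  interpret att: cycle_attachment "V - W" E u ws
    by unfold_locales (use E u uW ws lw Suc.prems(1) in auto)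
  have V: "V - W \<union> set ws = V" using ws W by blast
  have "deg (E \<union> att.D) v = 2 * r v" if "v \<in> V" for v
    using att.deg_attach[of v] deg_outside[OF att.simple, of v] E(4)[of v] W(1) u uW that ws(1)
    by (cases "v \<in> W"; cases "v = u") (auto simp: r'_def)
  then show ?case
    using att.cactus_attach att.bipartite_attach att.cyclic_edges_attach[OF E(3)] unfolding V by blast
qed

section \<open>Bipartite cacti with a connected core, and pendant edges\<close>

text \<open>Connectedness of the cyclic edges among themselves implies the core condition and is
  easy to preserve: a pendant edge creates no cycle.\<close>

definition cored :: "nat set \<Rightarrow> nat set set \<Rightarrow> bool" where
  "cored V E \<longleftrightarrow> cactus V E \<and> bipartite E \<and> connected_graph (\<Union> (cyclic_edges E)) (cyclic_edges E)"

lemma cored_bridgeless: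
  assumes "cactus V E" "bipartite E" "cyclic_edges E = E"
  shows "cored V E"
proof -
  have "\<Union> E \<subseteq> V" using assms(1) by (auto simp: cactus_def simple_graph_def)
  then have "connected_graph (\<Union> E) E"
    using assms(1) unfolding cactus_def connected_graph_def by (meson subsetD)
  then show ?thesis using assms by (simp add: cored_def)
qed

text \<open>A bridge lies on no cycle, since the rest of the cycle would bypass it. All cyclic edges
  thus survive its removal and keep any two vertices on cycles joined.\<close>

lemma cored_imp_core_bi_cactus:
  assumes "cored V E"
  shows "core_bi_cactus V E"
proof -
  have cac: "cactus V E" and bip: "bipartite E"
    and core: "connected_graph (\<Union> (cyclic_edges E)) (cyclic_edges E)"
    using assms by (auto simp: cored_def)
  have "reach (E - {e}) x y"
    if br: "bridge V E e" and C: "is_cycle (E - {e}) C1" "is_cycle (E - {e}) C2" "x \<in> \<Union> C1" "y \<in> \<Union> C2"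
    for e C1 C2 x y
  proof -
    have "e \<notin> cyclic_edges E"
    proof
      assume "e \<in> cyclic_edges E"
      then obtain vs where vs: "distinct vs" "length vs \<ge> 3" "e \<in> cycle_edges vs" "cycle_edges vs \<subseteq> E"
        unfolding cyclic_edges_def is_cycle_def by blast
      have "reach (E - {e}) a b" if "{a, b} \<in> E" for a b
      proof (cases "{a, b} = e")
        case True
        then have "reach (cycle_edges vs - {e}) a b"
          using reach_cycle_minus_edge[OF vs(1,2)] vs(3) by blast
        then show ?thesis by (rule reach_mono) (use vs(4) in auto)
      next
        case False
        then show ?thesis using that by (intro reach_edge) auto
      qed
      then have "connected_graph V (E - {e})"
        using cac reach_replace[of E _ _ "E - {e}"] unfolding cactus_def connected_graph_def by metis
      then show False using br unfolding bridge_def by blast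
    qed
    then have sub: "cyclic_edges E \<subseteq> E - {e}" using cyclic_edges_subset by blast
    have "is_cycle E C1" "is_cycle E C2" using C is_cycle_mono by blast+
    then have "x \<in> \<Union> (cyclic_edges E)" "y \<in> \<Union> (cyclic_edges E)"
      using C(3,4) unfolding cyclic_edges_def by blast+
    then have "reach (cyclic_edges E) x y" using core unfolding connected_graph_def by blast
    then show ?thesis using sub by (rule reach_mono)
  qed
  then show ?thesis
    unfolding core_bi_cactus_def core_cactus_def using cac bip by blast
qed

lemma pendant:
  assumes cored: "cored V E" and V: "finite V" and u: "u \<in> V" and w: "w \<notin> V"
  shows "cored (insert w V) (insert {u, w} E)"
    and "deg (insert {u, w} E) v = deg E v + (if v = u \<or> v = w then 1 else 0)"
proof -
  let ?E = "insert {u, w} E"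
  have cac: "cactus V E" and bip: "bipartite E" and simple: "simple_graph V E"
    and conn: "connected_graph V E"
    and core: "connected_graph (\<Union> (cyclic_edges E)) (cyclic_edges E)"
    using cored by (auto simp: cored_def cactus_def)
  have uw: "u \<noteq> w" using u w by auto
  have star_w: "{e \<in> E. w \<in> e} = {}" using simple w unfolding simple_graph_def by blast
  \<comment> \<open>A cycle through the new edge would need two edges at \<open>w\<close>, which has
    only one.\<close>
  have cyc: "is_cycle ?E C \<longleftrightarrow> is_cycle E C" for C
  proof
    assume C: "is_cycle ?E C"
    have "{u, w} \<notin> C"
    proof
      assume "{u, w} \<in> C"
      then have "deg C w = 2" using deg_is_cycle[OF C, of w] by blast
      moreover have "{e \<in> C. w \<in> e} \<subseteq> {{u, w}}" using is_cycle_subset[OF C] star_w by blast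
      then have "card {e \<in> C. w \<in> e} \<le> card {{u, w}}" by (intro card_mono) auto
      ultimately show False unfolding deg_def by simp
    qed
    then show "is_cycle E C" using is_cycle_restrict[OF C] is_cycle_subset[OF C] by blast
  qed (rule is_cycle_mono, auto)
  have "simple_graph (insert w V) ?E"
    using simple u uw unfolding simple_graph_def by auto
  moreover have "connected_graph (insert w V) ?E"
  proof (rule connected_graph_rooted)
    fix v assume "v \<in> insert w V"
    then consider "v = w" | "v \<in> V" by blast
    then show "reach ?E u v"
    proof cases
      case 1
      then show ?thesis by (intro reach_edge) auto
    next
      case 2
      then have "reach E u v" using conn u by (auto simp: connected_graph_def)
      then show ?thesis by (rule reach_mono) auto
    qed
  qed
  moreover have "C1 = C2" if "is_cycle ?E C1" "is_cycle ?E C2" "e \<in> C1" "e \<in> C2" for e C1 C2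
    using cactus_cycles_disjoint[OF cac] that cyc by blast
  ultimately have "cactus (insert w V) ?E" unfolding cactus_def by blast
  moreover have "bipartite ?E"
  proof -
    obtain f :: "nat \<Rightarrow> bool" where f: "\<And>a b. {a, b} \<in> E \<Longrightarrow> f a \<noteq> f b"
      using bip unfolding bipartite_def by blast
    let ?f = "f(w := \<not> f u)"
    have "?f a \<noteq> ?f b" if "{a, b} \<in> ?E" for a b
    proof (cases "{a, b} \<in> E")
      case True
      then have "a \<noteq> w" "b \<noteq> w" using simple_graph_edgeD[OF simple] w by blast+
      then show ?thesis using f[OF True] by simp
    next
      case False
      then have "{a, b} = {u, w}" using that by blast
      then show ?thesis using uw by (auto simp: doubleton_eq_iff)
    qed
    then show ?thesis unfolding bipartite_def by blast
  qed
  moreover have "cyclic_edges ?E = cyclic_edges E" unfolding cyclic_edges_def cyc ..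
  ultimately show "cored (insert w V) ?E" unfolding cored_def using core by simp
  have "{u, w} \<notin> E" using star_w by blast
  then have "deg ({{u, w}} \<union> E) v = deg {{u, w}} v + deg E v"
    using simple_graph_finite[OF simple V] by (intro deg_Un_disjoint) auto
  moreover have "deg {{u, w}} v = (if v = u \<or> v = w then 1 else 0)"
  proof -
    have "{e \<in> {{u, w}}. v \<in> e} = (if v = u \<or> v = w then {{u, w}} else {})" by auto
    then show ?thesis unfolding deg_def by simp
  qed
  ultimately show "deg ?E v = deg E v + (if v = u \<or> v = w then 1 else 0)" by simp
qed

text \<open>\<open>t v\<close> is the number of leaves still owed to \<open>v\<close>; each new leaf
  is hung on a vertex of \<open>V\<close> with a positive debt.\<close>

lemma pendants:
  fixes t :: "nat \<Rightarrow> nat"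
  assumes cored: "cored V E" and V: "finite V"
    and L: "finite L" "L \<inter> V = {}" "sum t V = card L"
  shows "\<exists>E'. cored (V \<union> L) E' \<and> (\<forall>v\<in>V. deg E' v = deg E v + t v) \<and> (\<forall>v\<in>L. deg E' v = 1)"
  using L
proof (induction L arbitrary: t rule: finite_induct)
  case empty
  then have "t v = 0" if "v \<in> V" for v using V that by simp
  then show ?case using cored by (intro exI[of _ E]) auto
next
  case (insert l L)
  have "sum t V > 0" using insert by simp
  then obtain u where u: "u \<in> V" "t u > 0" by (metis gr0I less_irrefl sum.neutral)
  define t' where "t' = t(u := t u - 1)"
  have "sum t' V = card L"
    using u V sum.remove[of V u t] sum.remove[of V u t'] insert by (simp add: t'_def)
  then obtain E' where E': "cored (V \<union> L) E'" "\<And>v. v \<in> V \<Longrightarrow> deg E' v = deg E v + t' v"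
    "\<And>v. v \<in> L \<Longrightarrow> deg E' v = 1" using insert.IH[of t'] insert.prems by auto
  have fin: "finite (V \<union> L)" and uL: "u \<in> V \<union> L" and l: "l \<notin> V \<union> L"
    using V insert u by auto
  have "simple_graph (V \<union> L) E'" using E'(1) by (auto simp: cored_def cactus_def)
  then have "deg E' l = 0" using l deg_outside by blast
  then have "\<forall>v\<in>V. deg (insert {u, l} E') v = deg E v + t v" "\<forall>v\<in>insert l L. deg (insert {u, l} E') v = 1"
    using pendant(2)[OF E'(1) fin uL l] E'(2,3) l u insert.prems(1) by (auto simp: t'_def)
  moreover have "cored (V \<union> insert l L) (insert {u, l} E')"
    using pendant(1)[OF E'(1) fin uL l] by simp
  ultimately show ?case by blast
qed

section \<open>Distributing the leaves and assembling the realization\<close>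

text \<open>Each vertex of odd degree first receives one leaf; the other leaves follow in pairs,
  each pair at a vertex with room, so parity is kept.\<close>

lemma leaf_distribution:
  fixes d :: "'a \<Rightarrow> nat"
  assumes U: "finite U" "\<And>v. v \<in> U \<Longrightarrow> d v \<ge> 2"
    and p: "p = card {v \<in> U. odd (d v)} + 2 * k" "p + 2 * card U \<le> sum d U"
  shows "\<exists>t. sum t U = p \<and> (\<forall>v\<in>U. even (d v + t v) \<and> t v + 2 \<le> d v)"
  using p
proof (induction k arbitrary: p)
  case 0
  let ?t = "\<lambda>v. of_bool (odd (d v)) :: nat"
  have "?t v + 2 \<le> d v" if "v \<in> U" for v using U(2)[OF that] by (cases "d v = 2") auto
  then show ?case using 0 U by (intro exI[of _ ?t]) (auto simp: card_Collect_eq_sum)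
next
  case (Suc k)
  then obtain t where t: "sum t U + 2 = p" "\<And>v. v \<in> U \<Longrightarrow> even (d v + t v)"
    "\<And>v. v \<in> U \<Longrightarrow> t v + 2 \<le> d v"
    using Suc.IH[of "p - 2"] by auto
  have "\<exists>v\<in>U. t v + 2 \<noteq> d v"
  proof (rule ccontr)
    assume "\<not> ?thesis"
    then have "(\<Sum>v\<in>U. t v + 2) = sum d U" by (intro sum.cong) auto
    then show False using t(1) Suc.prems(2) unfolding sum.distrib by simp
  qed
  then obtain u where u: "u \<in> U" "t u + 2 \<noteq> d u" by blast
  \<comment> \<open>The room \<open>d u - t u - 2\<close> is even and nonzero, so a pair
    fits.\<close>
  then have "t u + 4 \<le> d u" using t(2,3)[of u] by presburger
  moreover have "sum (t(u := t u + 2)) U = p"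
    using sum.remove[OF U(1) u(1), of t] sum.remove[OF U(1) u(1), of "t(u := t u + 2)"] t(1) by simp
  ultimately show ?case using t(2,3) by (intro exI[of _ "t(u := t u + 2)"]) auto
qed

lemma core_bi_cactus_sufficient:
  fixes d :: "nat \<Rightarrow> nat"
  assumes V: "finite V" "\<And>v. v \<in> V \<Longrightarrow> d v \<ge> 1"
    and leaf: "l \<in> V" "d l = 1"
    and odd: "card {v \<in> V. odd (d v) \<and> d v > 1} \<le> card {v \<in> V. d v = 1}"
    and m: "sum d V = 2 * m" "card V \<le> m" "3 * m + card {v \<in> V. d v = 1} + 4 \<le> 4 * card V"
  shows "\<exists>E. core_bi_cactus V E \<and> (\<forall>v\<in>V. deg E v = d v)"
proof -
  define L where "L = {v \<in> V. d v = 1}"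
  define U where "U = V - L"
  \<comment> \<open>A cactus with \<open>m\<close> edges has \<open>m - card V + 1\<close> cycles,
    so \<open>c\<close> are attached after the first.\<close>
  define c where "c = m - card V"
  have fin: "finite L" "finite U" and VU: "V = U \<union> L" "L \<inter> U = {}"
    using V(1) by (auto simp: L_def U_def)
  have dU: "d v \<ge> 2" if "v \<in> U" for v using V(2)[of v] that by (force simp: U_def L_def)
  have cV: "card V = card U + card L" and sV: "sum d V = sum d U + sum d L"
    unfolding VU(1) using fin VU(2) by (auto intro!: card_Un_disjoint sum.union_disjoint)
  have sL: "sum d L = card L" by (simp add: L_def)
  \<comment> \<open>The bound on \<open>m\<close>, after cancelling the leaves, says exactly that
    \<open>U\<close> can hold one 4-cycle and \<open>c\<close> attached ones.\<close>
  have cU: "3 * c + 4 \<le> card U" and sU: "sum d U = 2 * card U + card L + 2 * c"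
    using m cV sV sL unfolding c_def L_def[symmetric] by linarith+
  have oU: "{v \<in> V. odd (d v) \<and> d v > 1} = {v \<in> U. odd (d v)}"
  proof -
    have "d v > 1 \<longleftrightarrow> d v \<noteq> 1" if "v \<in> V" for v using V(2)[OF that] by linarith
    then show ?thesis unfolding U_def L_def by blast
  qed
  \<comment> \<open>Parity makes the leaves left after serving the odd vertices even in number, as
    pairing requires.\<close>
  have "even (card {v \<in> U. odd (d v)}) \<longleftrightarrow> even (card L)"
  proof -
    have "even (sum d U) \<longleftrightarrow> even (card {v \<in> U. odd (d v)})"
      using fin(2) by (rule even_sum_iff)
    then show ?thesis unfolding sU by simp
  qed
  moreover have le: "card {v \<in> U. odd (d v)} \<le> card L" using odd unfolding oU L_def .
  ultimately have "even (card L - card {v \<in> U. odd (d v)})" by simp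
  then obtain k where "card L - card {v \<in> U. odd (d v)} = 2 * k" by (elim evenE)
  with le have "card L = card {v \<in> U. odd (d v)} + 2 * k" by linarith
  then obtain t where t: "sum t U = card L" "\<And>v. v \<in> U \<Longrightarrow> even (d v + t v)"
    "\<And>v. v \<in> U \<Longrightarrow> t v + 2 \<le> d v"
    using leaf_distribution[of U d "card L" k] fin(2) dU sU by auto
  define r where "r v = (d v - t v) div 2" for v
  have r: "2 * r v + t v = d v" "r v \<ge> 1" if "v \<in> U" for v
    using t(2,3)[OF that] unfolding r_def by presburger+
  have "sum d U = (\<Sum>v\<in>U. 2 * r v + t v)" using r(1) by simp
  then have sr: "sum r U = card U + c"
    using sU t(1) by (simp add: sum.distrib flip: sum_distrib_left)
  have "\<exists>E t'. cored U E \<and> sum t' U = card L \<and> (\<forall>v\<in>U. deg E v + t' v = d v)"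
  proof (cases "even (card U - (3 * c + 4))")
    case True
    then obtain j where "card U = 3 * c + 4 + 2 * j" using cU by (metis evenE le_add_diff_inverse)
    then obtain E where "cactus U E" "bipartite E" "cyclic_edges E = E" "\<forall>v\<in>U. deg E v = 2 * r v"
      using bridgeless_bi_cactus_exists[OF fin(2) _ r(2) sr] by blast
    then show ?thesis using cored_bridgeless t(1) r(1) by (intro exI[of _ E] exI[of _ t]) auto
  next
    \<comment> \<open>A bridgeless bipartite cactus on \<open>U\<close> is excluded by parity, so some vertex \<open>v\<close> of \<open>U\<close>
      hangs off the core: it is inserted between \<open>u\<close> and one of the leaves at \<open>u\<close>.\<close>
    case False
    then obtain j where j: "card U = 3 * c + 4 + (2 * j + 1)" using cU by (metis oddE le_add_diff_inverse)
    have "l \<in> L" using leaf by (simp add: L_def)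
    then have "sum t U > 0" using t(1) fin(1) card_gt_0_iff by auto
    then obtain u where u: "u \<in> U" "t u > 0" by (metis gr0I less_irrefl sum.neutral)
    have "card U \<le> card {v \<in> U. r v = 1} + c" using card_ones[OF fin(2) r(2) sr] .
    \<comment> \<open>At least \<open>2 * c + 4\<close> vertices of \<open>U\<close> have
      \<open>r = 1\<close>, so one of them differs from \<open>u\<close>.\<close>
    then have "\<not> {v \<in> U. r v = 1} \<subseteq> {u}" using cU card_mono[of "{u}" "{v \<in> U. r v = 1}"] by auto
    then obtain v where v: "v \<in> U" "r v = 1" "v \<noteq> u" by blast
    have "card (U - {v}) = 3 * c + 4 + 2 * j" using j v(1) fin(2) by simp
    moreover have "sum r (U - {v}) = card (U - {v}) + c"
      using sr v sum.remove[OF fin(2) v(1), of r] card.remove[OF fin(2) v(1)] by linarith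
    ultimately obtain E where E: "cactus (U - {v}) E" "bipartite E" "cyclic_edges E = E"
      "\<And>w. w \<in> U - {v} \<Longrightarrow> deg E w = 2 * r w"
      using bridgeless_bi_cactus_exists[of "U - {v}" c j r] fin(2) r(2) by auto
    have uv: "finite (U - {v})" "u \<in> U - {v}" "v \<notin> U - {v}" "insert v (U - {v}) = U"
      using fin u v by auto
    note pend = pendant[OF cored_bridgeless[OF E(1-3)] uv(1-3)]
    \<comment> \<open>The edge to \<open>v\<close> replaces one leaf at \<open>u\<close>. At
      \<open>v\<close> it supplies one of the two edges that a cycle would have given, and the leaf
      taken over from \<open>u\<close> supplies the other.\<close>
    define t' where "t' = t(u := t u - 1, v := t v + 1)"
    have "sum t' U = card L"
      using t(1) u v fin(2) sum.remove[of U u t] sum.remove[of "U - {u}" v t]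
        sum.remove[of U u t'] sum.remove[of "U - {u}" v t'] by (simp add: t'_def)
    moreover have "deg E v = 0"
      using E(1) uv(3) deg_outside unfolding cactus_def by blast
    then have "deg (insert {u, v} E) w + t' w = d w" if "w \<in> U" for w
      using pend(2)[of w] E(4)[of w] r(1)[OF that] that u v by (auto simp: t'_def)
    ultimately show ?thesis using pend(1) unfolding uv(4) by blast
  qed
  then obtain E t' where E: "cored U E" "sum t' U = card L" "\<And>v. v \<in> U \<Longrightarrow> deg E v + t' v = d v"
    by blast
  then obtain E' where "cored (U \<union> L) E'" "\<And>v. v \<in> U \<Longrightarrow> deg E' v = d v" "\<And>v. v \<in> L \<Longrightarrow> deg E' v = 1"
    using pendants[OF E(1) fin(2,1) VU(2) E(2)] by auto
  then show ?thesis
    using cored_imp_core_bi_cactus unfolding VU(1) by (intro exI[of _ E']) (auto simp: L_def)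
qed

theorem theorem6p5:
  fixes n :: nat and d :: "nat \<Rightarrow> nat"
  assumes "degree_sequence n d"
    and "n \<ge> 4" and "d 4 \<ge> 2"
    and "(\<Sum>i=1..n. d i) > 2 * n"
    and "mu1 n d > 0"
  shows "(\<exists>E. realization n d E \<and> core_bi_cactus {1..n} E) \<longleftrightarrow>
         (mu1 n d \<ge> mu_odd n d \<and>
          real ((\<Sum>i=1..n. d i) div 2) \<le> of_int \<lfloor>(4 * (real n - 1) - real (mu1 n d)) / 3\<rfloor>)"
proof -
  define m where "m = (\<Sum>i=1..n. d i) div 2"
  have m: "(\<Sum>i=1..n. d i) = 2 * m" and d1: "\<And>i. i \<in> {1..n} \<Longrightarrow> d i \<ge> 1"
    using assms(1) unfolding degree_sequence_def m_def by auto
  have nm: "n < m" using assms(4) m by simp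
  \<comment> \<open>An integer is at most a floor iff it is at most the number itself, which leaves
    a linear inequality over the naturals.\<close>
  have "real m \<le> of_int \<lfloor>(4 * (real n - 1) - real (mu1 n d)) / 3\<rfloor>
      \<longleftrightarrow> int m \<le> \<lfloor>(4 * (real n - 1) - real (mu1 n d)) / 3\<rfloor>" by linarith
  also have "\<dots> \<longleftrightarrow> real (3 * m + mu1 n d + 4) \<le> real (4 * n)"
    unfolding le_floor_iff by (simp add: field_simps)
  finally have bound: "real m \<le> of_int \<lfloor>(4 * (real n - 1) - real (mu1 n d)) / 3\<rfloor>
      \<longleftrightarrow> 3 * m + mu1 n d + 4 \<le> 4 * n" by (simp only: of_nat_le_iff)
  show ?thesis unfolding m_def[symmetric] bound
  proof
    assume "\<exists>E. realization n d E \<and> core_bi_cactus {1..n} E"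
    then obtain E where E: "simple_graph {1..n} E" "\<And>i. i \<in> {1..n} \<Longrightarrow> deg E i = d i"
      "core_bi_cactus {1..n} E" unfolding realization_def by blast
    have "2 * card E = 2 * m" using sum_deg[OF _ E(1)] E(2) m by simp
    then have cE: "card E = m" by simp
    have mus: "mu1 n d = card {i \<in> {1..n}. deg E i = 1}"
      "mu_odd n d = card {i \<in> {1..n}. odd (deg E i) \<and> deg E i > 1}"
      unfolding mu1_def mu_odd_def using E(2) by (auto intro!: arg_cong[of _ _ card])
    show "mu_odd n d \<le> mu1 n d \<and> 3 * m + mu1 n d + 4 \<le> 4 * n"
      using core_bi_cactus_necessary[OF E(3)] cE nm assms(2) unfolding mus by simp
  next
    assume *: "mu_odd n d \<le> mu1 n d \<and> 3 * m + mu1 n d + 4 \<le> 4 * n"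
    obtain l where l: "l \<in> {1..n}" "d l = 1"
      using assms(5) unfolding mu1_def by (auto simp: card_gt_0_iff)
    obtain E where "core_bi_cactus {1..n} E" "\<And>v. v \<in> {1..n} \<Longrightarrow> deg E v = d v"
      using core_bi_cactus_sufficient[of "{1..n}" d l m] d1 l * m nm
      unfolding mu1_def mu_odd_def by auto
    then show "\<exists>E. realization n d E \<and> core_bi_cactus {1..n} E"
      by (intro exI[of _ E])
        (auto simp: realization_def core_bi_cactus_def core_cactus_def cactus_def)
  qed
qed

end
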